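(* Let $(X,d)$ be a metric space, $T:X\to X$ a self-mapping, $\zeta$ a simulation function and $x_0\in X$. Let $\rho=\inf_{x\in X}\{d(x,Tx)\mid Tx\neq x\}$. If $T$ is a $\mathcal{Z}_c$-contraction with respect to $\zeta$ with $x_0$, and the condition $0<d(Tx,x_0)\leq\rho$ holds for all $x\in D_{x_0,\rho}\setminus\{x_0\}$, then $D_{x_0,\rho}$ is a fixed disc of $T$.
   Context: A function $\zeta:[0,\infty)^2\to\mathbb{R}$ is a simulation function if: $(\zeta_1)$ $\zeta(0,0)=0$; $(\zeta_2)$ $\zeta(t,s)<s-t$ for all $s,t>0$; $(\zeta_3)$ if $\{t_n\},\{s_n\}$ are sequences in $(0,\infty)$ with $\lim_{n\to\infty}t_n=\lim_{n\to\infty}s_n>0$, then $\limsup_{n\to\infty}\zeta(t_n,s_n)<0$. $T$ is a $\mathcal{Z}_c$-contraction with respect to $\zeta$ with $x_0\in X$ if for all $x\in X$: $d(Tx,x)>0\Rightarrow\zeta\left(d(Tx,x),d(Tx,x_0)\right)\geq 0$. For $r\in[0,\infty)$, $D_{x_0,r}=\{x\in X: d(x,x_0)\leq r\}$. The disc $D_{x_0,r}$ is called a fixed disc of $T$ if $Tx=x$ for all $x\in D_{x_0,r}$. The number $\rho$ is taken to be an element of $[0,\infty)$. *)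

theory Defs
  imports "HOL-Analysis.Analysis"
begin

text \<open>
  A function on \<open>[0,\<infinity>)\<times>[0,\<infinity>)\<close> is represented by a total curried function on the reals, whose values
  are constrained and used at nonnegative arguments only. The limit superior is taken in the
  extended reals, since \<open>\<zeta> (t n) (s n)\<close> need not be bounded below.
\<close>

definition simulation_function :: "(real \<Rightarrow> real \<Rightarrow> real) \<Rightarrow> bool" where
  "simulation_function \<zeta> \<longleftrightarrow>
     \<zeta> 0 0 = 0 \<and>
     (\<forall>t>0. \<forall>s>0. \<zeta> t s < s - t) \<and>
     (\<forall>t s :: nat \<Rightarrow> real. \<forall>L>0.
        (\<forall>n. 0 < t n) \<longrightarrow> (\<forall>n. 0 < s n) \<longrightarrow> t \<longlonglongrightarrow> L \<longrightarrow> s \<longlonglongrightarrow> L \<longrightarrow>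
        limsup (\<lambda>n. ereal (\<zeta> (t n) (s n))) < 0)"

definition Zc_contraction ::
    "'a set \<Rightarrow> ('a \<Rightarrow> 'a \<Rightarrow> real) \<Rightarrow> ('a \<Rightarrow> 'a) \<Rightarrow> (real \<Rightarrow> real \<Rightarrow> real) \<Rightarrow> 'a \<Rightarrow> bool" where
  "Zc_contraction X d T \<zeta> x0 \<longleftrightarrow>
     (\<forall>x\<in>X. d (T x) x > 0 \<longrightarrow> \<zeta> (d (T x) x) (d (T x) x0) \<ge> 0)"

abbreviation disc :: "'a set \<Rightarrow> ('a \<Rightarrow> 'a \<Rightarrow> real) \<Rightarrow> 'a \<Rightarrow> real \<Rightarrow> 'a set" where
  "disc X d \<equiv> Metric_space.mcball X d"

definition fixed_disc ::
    "'a set \<Rightarrow> ('a \<Rightarrow> 'a \<Rightarrow> real) \<Rightarrow> ('a \<Rightarrow> 'a) \<Rightarrow> 'a \<Rightarrow> real \<Rightarrow> bool" where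
  "fixed_disc X d T x0 r \<longleftrightarrow> (\<forall>x \<in> disc X d x0 r. T x = x)"

text \<open>
  The number \<open>\<rho>\<close> is an element of \<open>[0,\<infinity>)\<close>. If \<open>T\<close> is the identity on \<open>X\<close>, the infimum ranges over the
  empty set and is not a real number; \<open>\<rho>\<close> is then left as an arbitrary nonnegative real, so that
  whatever is stated about \<open>\<rho>\<close> is claimed for every convention on the empty infimum.
\<close>

definition displacements :: "'a set \<Rightarrow> ('a \<Rightarrow> 'a \<Rightarrow> real) \<Rightarrow> ('a \<Rightarrow> 'a) \<Rightarrow> real set" where
  "displacements X d T = {d x (T x) | x. x \<in> X \<and> T x \<noteq> x}"

definition is_displacement_inf ::
    "'a set \<Rightarrow> ('a \<Rightarrow> 'a \<Rightarrow> real) \<Rightarrow> ('a \<Rightarrow> 'a) \<Rightarrow> real \<Rightarrow> bool" where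
  "is_displacement_inf X d T \<rho> \<longleftrightarrow>
     0 \<le> \<rho> \<and> (displacements X d T \<noteq> {} \<longrightarrow> \<rho> = Inf (displacements X d T))"

end

theory Submission
  imports Defs
begin

text \<open>A point x of the disc that T moves would satisfy two opposing estimates. The contraction
  inequality together with \<zeta> t s < s - t forces d(Tx,x) < d(Tx,x0)
  (\<open>Zc_contraction_displacement_less\<close>). The hypothesis on the disc and the choice of
  \<rho> as an infimum give d(Tx,x0) \<le> \<rho> \<le> d(Tx,x)
  (\<open>displacement_inf_le\<close>).\<close>

lemma displacement_inf_le:
  assumes "Metric_space X d" "is_displacement_inf X d T \<rho>" "x \<in> X" "T x \<noteq> x"
  shows "\<rho> \<le> d (T x) x"
proof -
  interpret Metric_space X d by fact
  have mem: "d x (T x) \<in> displacements X d T"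
    using assms(3,4) by (auto simp: displacements_def)
  have "bdd_below (displacements X d T)"
    by (rule bdd_belowI[where m = 0]) (auto simp: displacements_def)
  with mem have "Inf (displacements X d T) \<le> d x (T x)"
    by (rule cInf_lower)
  \<comment> \<open>The moved point x makes the displacement set nonempty, so \<rho> really is its
    infimum here and not an arbitrary nonnegative number.\<close>
  then show ?thesis
    using assms(2) mem by (auto simp: is_displacement_inf_def commute)
qed

text \<open>The value of \<zeta> at these two distances is squeezed: 0 \<le> \<zeta> < d(Tx,x0) -
  d(Tx,x). The upper bound requires both arguments to be strictly positive, hence the assumption 0 <
  d(Tx,x0).\<close>

lemma Zc_contraction_displacement_less:
  assumes "Metric_space X d" "T \<in> X \<rightarrow> X" "simulation_function \<zeta>" "Zc_contraction X d T \<zeta> x0"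
    and "x \<in> X" "T x \<noteq> x" "0 < d (T x) x0"
  shows "d (T x) x < d (T x) x0"
proof -
  interpret Metric_space X d by fact
  have pos: "0 < d (T x) x"
    using assms(2,5,6) by (intro mdist_pos_less) auto
  then have "0 \<le> \<zeta> (d (T x) x) (d (T x) x0)"
    using assms(4,5) by (auto simp: Zc_contraction_def)
  moreover have "\<zeta> (d (T x) x) (d (T x) x0) < d (T x) x0 - d (T x) x"
    using assms(3,7) pos by (auto simp: simulation_function_def)
  ultimately show ?thesis by linarith
qed

theorem theorem2p2:
  fixes X :: "'a set" and d :: "'a \<Rightarrow> 'a \<Rightarrow> real" and T :: "'a \<Rightarrow> 'a"
    and \<zeta> :: "real \<Rightarrow> real \<Rightarrow> real" and x0 :: 'a and \<rho> :: real
  assumes "Metric_space X d"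
    and "T \<in> X \<rightarrow> X"
    and "simulation_function \<zeta>"
    and "x0 \<in> X"
    and "is_displacement_inf X d T \<rho>"
    and "Zc_contraction X d T \<zeta> x0"
    and "\<forall>x \<in> disc X d x0 \<rho> - {x0}. 0 < d (T x) x0 \<and> d (T x) x0 \<le> \<rho>"
  shows "fixed_disc X d T x0 \<rho>"
proof -
  interpret Metric_space X d by fact
  have "T x = x" if x: "x \<in> mcball x0 \<rho>" for x
  proof (rule ccontr)
    assume ne: "T x \<noteq> x"
    have xX: "x \<in> X" using x by simp
    then have "T x \<in> X" using assms(2) by auto
    have pos: "0 < d (T x) x0"
    \<comment> \<open>The hypothesis on the disc omits the centre; there, positivity is just T x0
      \<noteq> x0.\<close>
    proof (cases "x = x0")
      case True
      then show ?thesis using ne xX \<open>T x \<in> X\<close> mdist_pos_less by blast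
    next
      case False
      then show ?thesis using assms(7) x by blast
    qed
    have less: "d (T x) x < d (T x) x0"
      by (rule Zc_contraction_displacement_less[OF assms(1-3,6) xX ne pos])
    \<comment> \<open>At the centre, \<open>less\<close> would compare d(T x0, x0) strictly with
      itself. With x0 excluded, the bound by \<rho> becomes available.\<close>
    then have "x \<noteq> x0" by auto
    then have "d (T x) x0 \<le> \<rho>" using assms(7) x by auto
    with less displacement_inf_le[OF assms(1,5) xX ne] show False by linarith
  qed
  then show ?thesis by (simp add: fixed_disc_def)
qed

end
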